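(* Suppose equilibria exist in the scenarios (NS) and (TLC). Then: (i) the equilibrium utility for workers in the scenario (TLC) is higher than that in the scenario (NS), i.e. $\rho^{\mathrm{TLC}}>\rho^{\mathrm{NS}}$; (ii) the total commuting cost in the scenario (TLC) is lower than that in the scenario (NS), i.e. $TC^{\mathrm{TLC}}<TC^{\mathrm{NS}}$.
   Context: Setting. There are locations $1,\dots,I$, indexed by increasing distance from a central business district (CBD). Location $i$ has land area $A_i>0$; each worker consumes one unit of land and there are $\sum_i A_i$ workers in total, so exactly $A_i$ workers live at $i$. Bottleneck capacities satisfy $\mu_1>\dots>\mu_I>0$; put $\mu_{I+1}=0$ and $\bar\mu_i=\mu_i-\mu_{i+1}$. Free-flow travel times are $f_i\ge 0$. Daily wages for office and remote work are $\theta^O>\theta^R$. The schedule delay cost for preferred arrival time $t_k$ is $\beta(t_k-t)$ if $t<t_k$ and $\gamma(t-t_k)$ if $t\ge t_k$, with $0<\beta<1$, $\gamma>0$ and $\gamma<\bar\mu_i/\mu_{i+1}$ for $i<I$; put $\delta=\beta\gamma/(\beta+\gamma)$. Let $K\in\{1,2\}$ be the number of preferred arrival times; for $K=2$ let $d=t_2-t_1>0$. If $X>0$ commuters use capacity $\mu$, the resulting short-term equilibrium commuting cost per trip (excluding free-flow time) is $\bar c_K(X,\mu)=\frac{X}{\mu}\delta-d(K-1)\delta$. Equilibrium. Given a set $\mathcal H\subseteq[0,1]$ of office work ratios and $K$, an equilibrium consists of an index $i^*\in\{1,\dots,I\}$, office work ratios $\eta(i)\in\mathcal H$ (all workers at $i$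 choose $\eta(i)$), land rents $r_i\ge0$ with $r_I=0$, costs $\kappa_i$, and a utility $\rho\in\mathbb R$ such that, with $X_i=\eta(i)A_i$: (a) $\eta(i)>0$ if and only if $i\le i^*$; (b) $\kappa_i=\bar c_K(X_i,\bar\mu_i)$ for $i\le i^*$, $\kappa_1<\dots<\kappa_{i^*}$, and $\kappa_i\ge\kappa_{i^*}$ for $i>i^*$; (c) if $K=2$, then $\kappa_i\ge d\delta$ for $i\le i^*$ (equivalently, the arrival time windows are intervals); (d) for all $i$ and all $h\in\mathcal H$, $h\big(\theta^O-\kappa_i-\sum_{j\le i}f_j\big)+(1-h)\theta^R-r_i\le\rho$, with equality for $h=\eta(i)$; (e) if $\mathcal H=[0,1]$, then $0<\eta(i^* )<1$ (location $i^*$ is the mixed zone). The equilibrium commuting cost $\lambda_i(\eta(i))$ is $\kappa_i$ for $i\le i^*$ and $0$ for $i>i^*$ (nobody commutes there). The total commuting cost is $TC=\sum_i\lambda_i(\eta(i))\,\eta(i)A_i$. Scenarios (all other parameters being the same), indicated by superscripts: (NS) no schemes: $\mathcal H=\{1\}$, $K=1$; (TLC) telecommuting: $\mathcal H=[0,1]$, $K=1$. *)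

theory Defs
  imports Complex_Main
begin

text \<open>
  Locations are the natural numbers \<open>1, \<dots>, I\<close>, ordered by distance from the CBD; the values of
  location-indexed fields at other indices are irrelevant. Each worker occupies one unit of land, so
  \<open>area i\<close> is also the number of workers living at \<open>i\<close>. The penalties \<open>\<beta>\<close> (\<open>early_rate\<close>) and
  \<open>\<gamma>\<close> (\<open>late_rate\<close>) give the schedule delay cost for preferred arrival time \<open>t\<^sub>k\<close>
  (\<open>pref_time k\<close>): \<open>\<beta> (t\<^sub>k - t)\<close> for \<open>t < t\<^sub>k\<close> and \<open>\<gamma> (t - t\<^sub>k)\<close> for \<open>t \<ge> t\<^sub>k\<close>.
\<close>

record city =
  num_locs :: nat
  area :: "nat \<Rightarrow> real"
  capacity :: "nat \<Rightarrow> real"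
  free_flow :: "nat \<Rightarrow> real"
  wage_office :: real
  wage_remote :: real
  early_rate :: real
  late_rate :: real
  pref_time :: "nat \<Rightarrow> real"

definition locs :: "city \<Rightarrow> nat set" where
  "locs C = {1..num_locs C}"

text \<open>The convention \<open>\<mu>\<^bsub>I+1\<^esub> = 0\<close> is built in.\<close>

definition mu :: "city \<Rightarrow> nat \<Rightarrow> real" where
  "mu C i = (if i \<in> locs C then capacity C i else 0)"

definition mubar :: "city \<Rightarrow> nat \<Rightarrow> real" where
  "mubar C i = mu C i - mu C (i + 1)"

definition delta :: "city \<Rightarrow> real" where
  "delta C = early_rate C * late_rate C / (early_rate C + late_rate C)"

definition gap :: "city \<Rightarrow> real" where
  "gap C = pref_time C 2 - pref_time C 1"

definition valid_city :: "city \<Rightarrow> bool" where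
  "valid_city C \<longleftrightarrow>
     num_locs C \<ge> 1 \<and>
     (\<forall>i\<in>locs C. area C i > 0) \<and>
     (\<forall>i\<in>locs C. \<forall>j\<in>locs C. i < j \<longrightarrow> mu C i > mu C j) \<and>
     (\<forall>i\<in>locs C. mu C i > 0) \<and>
     (\<forall>i\<in>locs C. free_flow C i \<ge> 0) \<and>
     wage_office C > wage_remote C \<and>
     0 < early_rate C \<and> early_rate C < 1 \<and>
     late_rate C > 0 \<and>
     (\<forall>i\<in>locs C. i < num_locs C \<longrightarrow> late_rate C < mubar C i / mu C (i + 1))"

text \<open>Equilibrium commuting cost per trip, without free-flow time, when \<open>X > 0\<close> commuters use a
  bottleneck of capacity \<open>m\<close> and there are \<open>K\<close> preferred arrival times.\<close>

definition trip_cost :: "city \<Rightarrow> nat \<Rightarrow> real \<Rightarrow> real \<Rightarrow> real" where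
  "trip_cost C K X m = X / m * delta C - gap C * (real K - 1) * delta C"

text \<open>The requirement \<open>d > 0\<close> is imposed only for \<open>K = 2\<close>; for \<open>K = 1\<close> the gap plays no role.\<close>

definition valid_scenario :: "city \<Rightarrow> real set \<Rightarrow> nat \<Rightarrow> bool" where
  "valid_scenario C H K \<longleftrightarrow> H \<subseteq> {0..1} \<and> K \<in> {1, 2} \<and> (K = 2 \<longrightarrow> gap C > 0)"

record allocation =
  last_office :: nat
  ratio :: "nat \<Rightarrow> real"
  rent :: "nat \<Rightarrow> real"
  cost :: "nat \<Rightarrow> real"
  utility :: real

definition commuters :: "city \<Rightarrow> allocation \<Rightarrow> nat \<Rightarrow> real" where
  "commuters C e i = ratio e i * area C i"

definition net_income :: "city \<Rightarrow> allocation \<Rightarrow> nat \<Rightarrow> real \<Rightarrow> real" where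
  "net_income C e i h =
     h * (wage_office C - cost e i - (\<Sum>j=1..i. free_flow C j)) + (1 - h) * wage_remote C - rent e i"

definition equilibrium :: "city \<Rightarrow> real set \<Rightarrow> nat \<Rightarrow> allocation \<Rightarrow> bool" where
  "equilibrium C H K e \<longleftrightarrow>
     valid_scenario C H K \<and>
     last_office e \<in> locs C \<and>
     (\<forall>i\<in>locs C. ratio e i \<in> H) \<and>
     (\<forall>i\<in>locs C. rent e i \<ge> 0) \<and> rent e (num_locs C) = 0 \<and>
     (\<forall>i\<in>locs C. ratio e i > 0 \<longleftrightarrow> i \<le> last_office e) \<and>
     (\<forall>i\<in>locs C. i \<le> last_office e \<longrightarrow>
        cost e i = trip_cost C K (commuters C e i) (mubar C i)) \<and>
     strict_mono_on {1..last_office e} (cost e) \<and>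
     (\<forall>i\<in>locs C. i > last_office e \<longrightarrow> cost e i \<ge> cost e (last_office e)) \<and>
     (K = 2 \<longrightarrow> (\<forall>i\<in>locs C. i \<le> last_office e \<longrightarrow> cost e i \<ge> gap C * delta C)) \<and>
     (\<forall>i\<in>locs C. (\<forall>h\<in>H. net_income C e i h \<le> utility e) \<and>
        net_income C e i (ratio e i) = utility e) \<and>
     (H = {0..1} \<longrightarrow> 0 < ratio e (last_office e) \<and> ratio e (last_office e) < 1)"

text \<open>Nobody commutes from locations beyond \<open>last_office\<close>, so their commuting cost counts as zero;
  \<open>cost\<close> there is only the cost a deviating commuter would face.\<close>

definition commuting_cost :: "allocation \<Rightarrow> nat \<Rightarrow> real" where
  "commuting_cost e i = (if i \<le> last_office e then cost e i else 0)"

definition total_commuting_cost :: "city \<Rightarrow> allocation \<Rightarrow> real" where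
  "total_commuting_cost C e = (\<Sum>i\<in>locs C. commuting_cost e i * commuters C e i)"

definition NS_equilibrium :: "city \<Rightarrow> allocation \<Rightarrow> bool" where
  "NS_equilibrium C e \<longleftrightarrow> equilibrium C {1} 1 e"

definition TLC_equilibrium :: "city \<Rightarrow> allocation \<Rightarrow> bool" where
  "TLC_equilibrium C e \<longleftrightarrow> equilibrium C {0..1} 1 e"

end

theory Submission imports Defs begin

text \<open>In a telecommuting equilibrium workers in the mixed zone are indifferent between office and
  remote work, and the rent vanishes at the boundary location, so the utility equals the remote
  wage. Without telecommuting the utility is that of an office worker at the boundary. An office
  worker in the mixed zone earns exactly the remote wage there, at a lower commuting cost and
  free-flow time than a boundary worker faces without telecommuting. The total cost is quadratic in
  the office ratios, which telecommuting lowers weakly everywhere and strictly in the mixed zone.\<close>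

lemma delta_pos: "valid_city C \<Longrightarrow> delta C > 0"
  by (simp add: valid_city_def delta_def)

text \<open>Capacities strictly decrease with distance; at the outermost location the convention
  that the next capacity is 0 leaves \<open>mubar\<close> equal to a positive capacity.\<close>

lemma mubar_pos:
  assumes "valid_city C" "i \<in> locs C"
  shows "mubar C i > 0"
proof (cases "i + 1 \<in> locs C")
  case True
  with assms show ?thesis
    by (auto simp: valid_city_def mubar_def)
next
  case False
  then have "mu C (i + 1) = 0"
    by (simp add: mu_def)
  with assms show ?thesis
    by (simp add: valid_city_def mubar_def)
qed

text \<open>For one preferred arrival time the \<open>gap\<close> term drops out, so the cost is
  linear in the office ratio. The remaining factor depends on the city alone, which makes costs
  comparable across scenarios.\<close>

lemma trip_cost_single:
  "trip_cost C 1 (commuters C e i) (mubar C i) = ratio e i * (area C i / mubar C i * delta C)"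
  by (simp add: trip_cost_def commuters_def)

lemma NS_equilibriumD:
  assumes "valid_city C" "NS_equilibrium C e"
  shows NS_ratio: "\<And>i. i \<in> locs C \<Longrightarrow> ratio e i = 1"
    and NS_last_office: "last_office e = num_locs C"
    and NS_cost: "\<And>i. i \<in> locs C \<Longrightarrow> cost e i = area C i / mubar C i * delta C"
    and NS_cost_mono: "\<And>i. i \<in> locs C \<Longrightarrow> cost e i \<le> cost e (num_locs C)"
    and NS_utility: "utility e =
      wage_office C - cost e (num_locs C) - (\<Sum>j=1..num_locs C. free_flow C j)"
proof -
  have eq: "equilibrium C {1} 1 e"
    using assms(2) by (simp add: NS_equilibrium_def)
  have I: "num_locs C \<in> locs C"
    using assms(1) by (simp add: valid_city_def locs_def)
  show r: "ratio e i = 1" if "i \<in> locs C" for i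
    using eq that by (simp add: equilibrium_def)
  show L: "last_office e = num_locs C"
  proof (rule antisym)
    show "last_office e \<le> num_locs C"
      using eq by (simp add: equilibrium_def locs_def)
    \<comment> \<open>The outermost location has ratio 1, which is positive, so it lies within the
      office zone.\<close>
    show "num_locs C \<le> last_office e"
      using eq I r[OF I] by (force simp: equilibrium_def)
  qed
  show "cost e i = area C i / mubar C i * delta C" if "i \<in> locs C" for i
  proof -
    have "i \<le> last_office e"
      using that L by (simp add: locs_def)
    then have "cost e i = trip_cost C 1 (commuters C e i) (mubar C i)"
      using eq that by (simp add: equilibrium_def)
    then show ?thesis
      by (simp only: trip_cost_single r[OF that] mult_1)
  qed
  show "cost e i \<le> cost e (num_locs C)" if "i \<in> locs C" for i
  proof -
    have "strict_mono_on {1..num_locs C} (cost e)"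
      using eq L by (simp add: equilibrium_def)
    then show ?thesis
      using that I by (auto simp: locs_def intro: strict_mono_on_leD)
  qed
  have "net_income C e (num_locs C) (ratio e (num_locs C)) = utility e" "rent e (num_locs C) = 0"
    using eq I by (auto simp: equilibrium_def)
  then show "utility e =
      wage_office C - cost e (num_locs C) - (\<Sum>j=1..num_locs C. free_flow C j)"
    using r[OF I] by (simp add: net_income_def)
qed

text \<open>Income is affine in the ratio \<open>h\<close>, so an optimal ratio strictly inside the
  unit interval forces its slope to vanish.\<close>

lemma TLC_equilibriumD:
  assumes "valid_city C" "TLC_equilibrium C e"
  shows TLC_last_office: "last_office e \<in> locs C"
    and TLC_ratio: "\<And>i. i \<in> locs C \<Longrightarrow> 0 \<le> ratio e i \<and> ratio e i \<le> 1"
    and TLC_ratio_mixed: "0 < ratio e (last_office e)" "ratio e (last_office e) < 1"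
    and TLC_cost: "\<And>i. i \<in> locs C \<Longrightarrow> i \<le> last_office e \<Longrightarrow>
      cost e i = ratio e i * (area C i / mubar C i * delta C)"
    and TLC_indifference: "wage_office C - cost e (last_office e)
      - (\<Sum>j=1..last_office e. free_flow C j) = wage_remote C"
    and TLC_utility: "utility e = wage_remote C"
proof -
  have eq: "equilibrium C {0..1} 1 e"
    using assms(2) by (simp add: TLC_equilibrium_def)
  have I: "num_locs C \<in> locs C"
    using assms(1) by (simp add: valid_city_def locs_def)
  show L: "last_office e \<in> locs C"
    using eq by (simp add: equilibrium_def)
  show r: "0 \<le> ratio e i \<and> ratio e i \<le> 1" if "i \<in> locs C" for i
    using eq that by (simp add: equilibrium_def)
  show m: "0 < ratio e (last_office e)" "ratio e (last_office e) < 1"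
    using eq by (simp_all add: equilibrium_def)
  show "cost e i = ratio e i * (area C i / mubar C i * delta C)"
    if "i \<in> locs C" "i \<le> last_office e" for i
    unfolding trip_cost_single[symmetric] using eq that by (simp add: equilibrium_def)
  have opt: "net_income C e i h \<le> utility e" if "i \<in> locs C" "0 \<le> h" "h \<le> 1" for i h
    using eq that by (simp add: equilibrium_def)
  have att: "net_income C e i (ratio e i) = utility e" if "i \<in> locs C" for i
    using eq that by (simp add: equilibrium_def)
  define w where "w = wage_office C - cost e (last_office e)
    - (\<Sum>j=1..last_office e. free_flow C j)"
  define \<eta> where "\<eta> = ratio e (last_office e)"
  have ni: "net_income C e (last_office e) h =
      h * w + (1 - h) * wage_remote C - rent e (last_office e)" for h
    by (simp add: net_income_def w_def)
  have "w = wage_remote C"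
  proof (rule antisym)
    \<comment> \<open>Deviations to full office work here and to full remote work below: the rent
      cancels, and \<open>\<eta>\<close> strictly between 0 and 1 fixes the sign of the other
      factor.\<close>
    have "(1 - \<eta>) * (w - wage_remote C) \<le> 0"
      using opt[OF L, of 1] att[OF L] by (simp add: ni \<eta>_def algebra_simps)
    then show "w \<le> wage_remote C"
      using m by (simp add: \<eta>_def mult_le_0_iff)
    have "0 \<le> \<eta> * (w - wage_remote C)"
      using opt[OF L, of 0] att[OF L] by (simp add: ni \<eta>_def algebra_simps)
    then show "wage_remote C \<le> w"
      using m by (simp add: \<eta>_def zero_le_mult_iff)
  qed
  then show ind: "wage_office C - cost e (last_office e)
      - (\<Sum>j=1..last_office e. free_flow C j) = wage_remote C"
    by (simp add: w_def)
  have r0: "rent e (num_locs C) = 0"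
    using eq by (simp add: equilibrium_def)
  show "utility e = wage_remote C"
  \<comment> \<open>Utility is read off at the outermost location, where the rent is 0. Either it is
    the mixed zone, whose income is the remote wage by indifference, or its ratio is 0 and everybody
    there works remotely.\<close>
  proof (cases "last_office e = num_locs C")
    case True
    then show ?thesis
      using att[OF L, unfolded ni] \<open>w = wage_remote C\<close> r0 by (simp add: algebra_simps)
  next
    case False
    then have "\<not> num_locs C \<le> last_office e"
      using L by (simp add: locs_def)
    then have "\<not> 0 < ratio e (num_locs C)"
      using eq I unfolding equilibrium_def by blast
    then have "ratio e (num_locs C) = 0"
      using r[OF I] by simp
    then show ?thesis
      using att[OF I] r0 by (simp add: net_income_def)
  qed
qed

theorem theorem2:
  fixes C :: city and eNS eTLC :: allocation
  assumes "valid_city C"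
    and "NS_equilibrium C eNS"
    and "TLC_equilibrium C eTLC"
  shows "utility eTLC > utility eNS \<and>
         total_commuting_cost C eTLC < total_commuting_cost C eNS"
proof
  note NS = NS_equilibriumD[OF assms(1,2)]
  \<comment> \<open>\<open>TLC_ratio_mixed\<close> consists of two facts, hence the cost formula is
    \<open>TLC(5)\<close>.\<close>
  note TLC = TLC_equilibriumD[OF assms(1,3)]
  define l where "l = last_office eTLC"
  define k where "k i = area C i / mubar C i * delta C" for i
  have l: "l \<in> locs C"
    using TLC(1) by (simp add: l_def)
  have A: "area C i > 0" if "i \<in> locs C" for i
    using assms(1) that by (simp add: valid_city_def)
  have k: "k i > 0" if "i \<in> locs C" for i
    using A[OF that] mubar_pos[OF assms(1) that] delta_pos[OF assms(1)] by (simp add: k_def)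
  have costT: "cost eTLC i = ratio eTLC i * k i" if "i \<in> locs C" "i \<le> l" for i
    using TLC(5) that by (simp add: k_def l_def)
  have costN: "cost eNS i = k i" if "i \<in> locs C" for i
    using NS(3) that by (simp add: k_def)
  show "utility eTLC > utility eNS"
  proof -
    \<comment> \<open>The only source of strictness: the ratio in the mixed zone is below 1.\<close>
    have "cost eTLC l < cost eNS l"
      using costT[OF l] costN[OF l] k[OF l] TLC(4) by (simp add: l_def)
    also have "\<dots> \<le> cost eNS (num_locs C)"
      using NS(4) l by simp
    finally have "cost eTLC l < cost eNS (num_locs C)" .
    moreover have "(\<Sum>j=1..l. free_flow C j) \<le> (\<Sum>j=1..num_locs C. free_flow C j)"
      using l assms(1) by (intro sum_mono2) (auto simp: locs_def valid_city_def)
    ultimately show ?thesis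
      using NS(5) TLC(6,7) by (simp add: l_def)
  qed
  have N: "commuting_cost eNS i * commuters C eNS i = k i * area C i" if "i \<in> locs C" for i
    using NS(1,2) costN that by (simp add: commuting_cost_def commuters_def locs_def)
  \<comment> \<open>One factor of the square comes from the cost per trip, the other from the number
    of commuters.\<close>
  have T: "commuting_cost eTLC i * commuters C eTLC i =
      (if i \<le> l then (ratio eTLC i)\<^sup>2 * (k i * area C i) else 0)" if "i \<in> locs C" for i
    using costT that by (simp add: commuting_cost_def commuters_def l_def power2_eq_square)
  show "total_commuting_cost C eTLC < total_commuting_cost C eNS"
    unfolding total_commuting_cost_def
  proof (rule sum_strict_mono_ex1)
    show "finite (locs C)"
      by (simp add: locs_def)
    show "\<forall>i\<in>locs C. commuting_cost eTLC i * commuters C eTLC i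
        \<le> commuting_cost eNS i * commuters C eNS i"
    proof
      fix i assume i: "i \<in> locs C"
      have "(ratio eTLC i)\<^sup>2 \<le> 1"
        using TLC(2)[OF i] by (simp add: power_le_one)
      moreover have "0 < k i * area C i"
        using k A i by simp
      ultimately show "commuting_cost eTLC i * commuters C eTLC i
          \<le> commuting_cost eNS i * commuters C eNS i"
        using N[OF i] T[OF i] by (simp add: mult_le_cancel_right2)
    qed
    \<comment> \<open>The mixed zone \<open>l\<close> witnesses the one strict inequality required;
      elsewhere in the office zone the ratio may equal 1.\<close>
    have "(ratio eTLC l)\<^sup>2 < 1"
      using TLC(3,4) by (simp add: l_def power_less_one_iff)
    moreover have "0 < k l * area C l"
      using k A l by simp
    ultimately have "commuting_cost eTLC l * commuters C eTLC l
        < commuting_cost eNS l * commuters C eNS l"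
      using N[OF l] T[OF l] by (simp add: mult_less_cancel_right2)
    with l show "\<exists>i\<in>locs C. commuting_cost eTLC i * commuters C eTLC i
        < commuting_cost eNS i * commuters C eNS i"
      by blast
  qed
qed

end
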